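(* Let $L$ and $M$ be distributive lattices, let $n\in\mathbb{N}$ with $n\geq 2$, and let $T\colon L^n\to M$ be a lattice $n$-homomorphism. Then $T$ is total orderization invariant if and only if $T$ is symmetric.
   Context: A map $T\colon L^n\to M$ between lattices is a lattice $n$-homomorphism if it is a lattice homomorphism in each variable separately, i.e. for all $x_1,\dots,x_n,y\in L$ and $i\in\{1,\dots,n\}$, $T(x_1,\dots,x_{i-1},x_i\vee y,x_{i+1},\dots,x_n)=T(x_1,\dots,x_n)\vee T(x_1,\dots,x_{i-1},y,x_{i+1},\dots,x_n)$, and likewise with $\vee$ replaced by $\wedge$ throughout. $T$ is symmetric if its value is unchanged under every permutation of its arguments. For $x_1,\dots,x_n\in L$ and $k\in\{1,\dots,n\}$, the $k$th median is $$\mathcal{M}_k(x_1,\dots,x_n):=\bigvee_{1\leq i_1<i_2<\cdots<i_{n+1-k}\leq n}\ \bigwedge_{j=1}^{n+1-k}x_{i_j}.$$ A map $T$ on $L^n$ is total orderization invariant if $T(x_1,\dots,x_n)=T\bigl(\mathcal{M}_1(x_1,\dots,x_n),\dots,\mathcal{M}_n(x_1,\dots,x_n)\bigr)$ for all $x_1,\dots,x_n\in L$. *)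

theory Defs
  imports "HOL-Combinatorics.Permutations"
begin

text \<open>
  An element (x_1, ..., x_n) of L^n is a list of length n over the type L, so that the entry x_i
  is \<open>xs ! (i - 1)\<close>. A map on L^n is a function on lists of which only the values on lists of
  length n matter; every definition below is restricted to such lists.
\<close>

definition lattice_n_hom :: "nat \<Rightarrow> ('a::lattice list \<Rightarrow> 'b::lattice) \<Rightarrow> bool" where
  "lattice_n_hom n T \<longleftrightarrow>
    (\<forall>xs y i. length xs = n \<longrightarrow> i < n \<longrightarrow>
      T (xs[i := sup (xs ! i) y]) = sup (T xs) (T (xs[i := y])) \<and>
      T (xs[i := inf (xs ! i) y]) = inf (T xs) (T (xs[i := y])))"

definition symmetric_map :: "nat \<Rightarrow> ('a list \<Rightarrow> 'b) \<Rightarrow> bool" where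
  "symmetric_map n T \<longleftrightarrow>
    (\<forall>xs p. length xs = n \<longrightarrow> p permutes {..<n} \<longrightarrow> T (permute_list p xs) = T xs)"

text \<open>
  The index tuples \<open>i_1 < ... < i_m\<close> with \<open>m = n + 1 - k\<close> are represented by the sets \<open>I\<close> of their
  entries. The parameter \<open>k\<close> is 1-based; for \<open>1 \<le> k \<le> n\<close> each \<open>I\<close> and the family of all \<open>I\<close>
  are finite and nonempty, as required by \<open>Inf_fin\<close> and \<open>Sup_fin\<close>.
\<close>
definition median :: "nat \<Rightarrow> 'a::lattice list \<Rightarrow> 'a" where
  "median k xs =
    Sup_fin ((\<lambda>I. Inf_fin ((\<lambda>i. xs ! i) ` I)) `
      {I. I \<subseteq> {..<length xs} \<and> card I = length xs + 1 - k})"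

definition total_orderization_invariant :: "nat \<Rightarrow> ('a::lattice list \<Rightarrow> 'b) \<Rightarrow> bool" where
  "total_orderization_invariant n T \<longleftrightarrow>
    (\<forall>xs. length xs = n \<longrightarrow> T xs = T (map (\<lambda>k. median k xs) [1..<n + 1]))"

end

theory Submission imports Defs begin

text \<open>
  Replacing two adjacent entries \<open>a, b\<close> by \<open>inf a b, sup a b\<close> changes neither the medians nor the
  value of a symmetric lattice \<open>n\<close>-homomorphism. Insertion sort built from these exchanges turns
  every list into an ascending chain, and an ascending chain is its own list of medians.
  Conversely, the medians are symmetric functions of the entries.
\<close>

section \<open>Insertion sort in a lattice\<close>

text \<open>Entries may be incomparable, so the pair \<open>inf x y\<close>, \<open>sup x y\<close>
  takes the place of a comparison. On a sorted list over a linear order this is ordinary insertion;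
  in general the output contains new elements.\<close>

fun lattice_insort :: "'a::lattice \<Rightarrow> 'a list \<Rightarrow> 'a list" where
  "lattice_insort x [] = [x]"
| "lattice_insort x (y # ys) = inf x y # lattice_insort (sup x y) ys"

fun lattice_sort :: "'a::lattice list \<Rightarrow> 'a list" where
  "lattice_sort [] = []"
| "lattice_sort (x # xs) = lattice_insort x (lattice_sort xs)"

lemma length_lattice_insort [simp]: "length (lattice_insort x ys) = Suc (length ys)"
  by (induction ys arbitrary: x) auto

lemma length_lattice_sort [simp]: "length (lattice_sort xs) = length xs"
  by (induction xs) auto

lemma lattice_insort_lower_bound:
  assumes "z \<le> x" "\<forall>y\<in>set ys. z \<le> y" "w \<in> set (lattice_insort x ys)"
  shows "z \<le> w"
  using assms by (induction ys arbitrary: x) (auto intro: le_supI1)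

lemma sorted_wrt_lattice_insort:
  "sorted_wrt (\<le>) ys \<Longrightarrow> sorted_wrt (\<le>) (lattice_insort x ys)"
proof (induction ys arbitrary: x)
  case (Cons y ys)
  have "inf x y \<le> w" if "w \<in> set (lattice_insort (sup x y) ys)" for w
    by (rule lattice_insort_lower_bound[OF _ _ that])
       (use Cons.prems in \<open>auto intro: le_supI1 le_infI2\<close>)
  with Cons show ?case by auto
qed simp

lemma sorted_wrt_lattice_sort: "sorted_wrt (\<le>) (lattice_sort xs)"
  by (induction xs) (auto simp: sorted_wrt_lattice_insort)

text \<open>The exchanges take place ever deeper in the list, so the induction moves each finished
  entry \<open>inf x y\<close> into the prefix \<open>us\<close>; the total length stays
  \<open>n\<close>. The function \<open>f\<close> is arbitrary because both a median and a symmetric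
  map are to be inserted for it.\<close>

lemma exchange_invariant_lattice_insort:
  assumes exch: "\<And>us a b vs. length us + length vs + 2 = n \<Longrightarrow>
      f (us @ a # b # vs) = f (us @ inf a b # sup a b # vs)"
    and "length us + length ys + 1 = n"
  shows "f (us @ x # ys) = f (us @ lattice_insort x ys)"
  using assms(2)
proof (induction ys arbitrary: us x)
  case (Cons y ys)
  have "f (us @ x # y # ys) = f ((us @ [inf x y]) @ sup x y # ys)"
    using exch[of us ys x y] Cons.prems by simp
  also have "\<dots> = f ((us @ [inf x y]) @ lattice_insort (sup x y) ys)"
    by (rule Cons.IH) (use Cons.prems in simp)
  finally show ?case by simp
qed simp

lemma exchange_invariant_lattice_sort:
  assumes exch: "\<And>us a b vs. length us + length vs + 2 = n \<Longrightarrow>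
      f (us @ a # b # vs) = f (us @ inf a b # sup a b # vs)"
    and "length us + length xs = n"
  shows "f (us @ xs) = f (us @ lattice_sort xs)"
  using assms(2)
proof (induction xs arbitrary: us)
  case (Cons x xs)
  have "f ((us @ [x]) @ xs) = f ((us @ [x]) @ lattice_sort xs)"
    by (rule Cons.IH) (use Cons.prems in simp)
  also have "\<dots> = f (us @ x # lattice_sort xs)" by simp
  also have "\<dots> = f (us @ lattice_insort x (lattice_sort xs))"
    by (rule exchange_invariant_lattice_insort[where n = n, OF exch])
       (use Cons.prems in auto)
  finally show ?case by simp
qed simp

section \<open>Medians of chains and of permuted lists\<close>

lemma finite_index_sets: "finite {I. I \<subseteq> {..<n::nat} \<and> card I = m}"
  by (rule finite_subset[of _ "Pow {..<n}"]) auto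

lemma Inf_fin_le_median:
  assumes "I \<subseteq> {..<length xs}" "card I = length xs + 1 - k"
  shows "Inf_fin ((!) xs ` I) \<le> median k xs"
  unfolding median_def
  by (rule Sup_fin.coboundedI) (use assms finite_index_sets in auto)

text \<open>The bound \<open>1 \<le> k\<close> makes the family of index sets nonempty, and
  \<open>k \<le> length xs\<close> makes each of its members nonempty, so the join and the meets are
  genuine.\<close>

lemma median_leI:
  assumes "1 \<le> k" "k \<le> length xs"
    and "\<And>I. I \<subseteq> {..<length xs} \<Longrightarrow> card I = length xs + 1 - k \<Longrightarrow>
      finite I \<Longrightarrow> I \<noteq> {} \<Longrightarrow> Inf_fin ((!) xs ` I) \<le> z"
  shows "median k xs \<le> z"
  unfolding median_def
proof (rule Sup_fin.boundedI)
  have "{..<length xs + 1 - k} \<in> {I. I \<subseteq> {..<length xs} \<and> card I = length xs + 1 - k}"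
    using assms(1) by auto
  then show "(\<lambda>I. Inf_fin ((!) xs ` I)) ` {I. I \<subseteq> {..<length xs} \<and> card I = length xs + 1 - k} \<noteq> {}"
    by blast
next
  fix a
  assume "a \<in> (\<lambda>I. Inf_fin ((!) xs ` I)) ` {I. I \<subseteq> {..<length xs} \<and> card I = length xs + 1 - k}"
  then obtain I where I: "I \<subseteq> {..<length xs}" "card I = length xs + 1 - k"
    and a: "a = Inf_fin ((!) xs ` I)" by auto
  have "finite I" using I(1) finite_subset by blast
  moreover have "I \<noteq> {}" using I(2) assms(2) by auto
  ultimately show "a \<le> z" using assms(3) I a by blast
qed (simp add: finite_index_sets)

lemma median_sorted:
  assumes "sorted_wrt (\<le>) xs" "1 \<le> k" "k \<le> length xs"
  shows "median k xs = xs ! (k - 1)"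
proof (rule antisym)
  have mono: "xs ! i \<le> xs ! j" if "i \<le> j" "j < length xs" for i j
    using assms(1) that by (cases "i = j") (auto simp: sorted_wrt_iff_nth_less)
  show "median k xs \<le> xs ! (k - 1)"
  proof (rule median_leI[OF assms(2,3)])
    fix I assume I: "I \<subseteq> {..<length xs}" "card I = length xs + 1 - k" "finite I"
    \<comment> \<open>Pigeonhole: only \<open>length xs - k\<close> positions lie beyond the 0-based
      position \<open>k - 1\<close>, one fewer than \<open>I\<close> has elements.\<close>
    have "\<exists>i\<in>I. i \<le> k - 1"
    proof (rule ccontr)
      assume "\<not> ?thesis"
      with I(1) have "I \<subseteq> {k..<length xs}" using assms(2) by fastforce
      then have "card I \<le> length xs - k" using card_mono[of "{k..<length xs}" I] by simp
      with I(2) assms(3) show False by simp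
    qed
    then obtain i where i: "i \<in> I" "i \<le> k - 1" by blast
    have "Inf_fin ((!) xs ` I) \<le> xs ! i"
      by (rule Inf_fin.coboundedI) (use I i in auto)
    also have "\<dots> \<le> xs ! (k - 1)" by (rule mono) (use i assms in auto)
    finally show "Inf_fin ((!) xs ` I) \<le> xs ! (k - 1)" .
  qed
  \<comment> \<open>The final segment starting at \<open>k - 1\<close> has exactly the required
    size, and its meet attains the bound.\<close>
  have "xs ! (k - 1) \<le> Inf_fin ((!) xs ` {k - 1..<length xs})"
    by (rule Inf_fin.boundedI) (use assms(2,3) in \<open>auto intro!: mono\<close>)
  also have "\<dots> \<le> median k xs"
    by (rule Inf_fin_le_median) (use assms(2,3) in auto)
  finally show "xs ! (k - 1) \<le> median k xs" .
qed

lemma medians_sorted: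
  assumes "sorted_wrt (\<le>) xs"
  shows "map (\<lambda>k. median k xs) [1..<length xs + 1] = xs"
  by (rule nth_equalityI) (use median_sorted[OF assms] in \<open>auto simp del: upt_Suc\<close>)

text \<open>A permutation of the positions permutes the index sets of a given size, so it only
  reindexes the join.\<close>

lemma median_permute_list:
  assumes p: "p permutes {..<length xs}"
  shows "median k (permute_list p xs) = median k xs"
proof -
  let ?F = "{I. I \<subseteq> {..<length xs} \<and> card I = length xs + 1 - k}"
  have img: "q ` I \<in> ?F" if "q permutes {..<length xs}" "I \<in> ?F" for q I
    using that permutes_image[OF that(1)]
    by (auto simp: card_image permutes_inj_on image_subset_iff permutes_in_image subset_iff)
  have "I \<in> (`) p ` ?F" if "I \<in> ?F" for I
  proof
    show "I = p ` (inv p ` I)" using permutes_surj[OF p] by (simp add: image_f_inv_f)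
    show "inv p ` I \<in> ?F" by (rule img[OF permutes_inv[OF p] that])
  qed
  then have F: "(`) p ` ?F = ?F" using img[OF p] by blast
  have "(!) (permute_list p xs) ` I = (!) xs ` p ` I" if "I \<in> ?F" for I
    using that p by (force simp: permute_list_nth image_iff)
  then have "(\<lambda>I. Inf_fin ((!) (permute_list p xs) ` I)) ` ?F
      = (\<lambda>I. Inf_fin ((!) xs ` I)) ` ((`) p ` ?F)"
    unfolding image_image[of _ "(`) p"] by (intro image_cong) auto
  then show ?thesis unfolding median_def F by simp
qed

section \<open>Invariance of medians under exchanges\<close>

lemma median_exchange:
  fixes xs ys :: "'a::distrib_lattice list"
  assumes len: "length ys = length xs"
    and ij: "i < length xs" "j < length xs" "i \<noteq> j"
    and yi: "ys ! i = inf (xs ! i) (xs ! j)"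
    and yj: "ys ! j = sup (xs ! i) (xs ! j)"
    and eq: "\<And>l. l \<noteq> i \<Longrightarrow> l \<noteq> j \<Longrightarrow> ys ! l = xs ! l"
    and k: "1 \<le> k" "k \<le> length xs"
  shows "median k xs = median k ys"
proof (rule antisym)
  define swp where "swp a b I = insert b (I - {a})" for a b :: nat and I
  have swp: "swp a b I \<subseteq> {..<length xs}" "card (swp a b I) = card I"
    if "I \<subseteq> {..<length xs}" "finite I" "a \<in> I" "b \<notin> I" "b < length xs" for a b I
    using that card_Suc_Diff1[of I a] by (auto simp: swp_def)
  have lower: "Inf_fin ((!) zs ` I) \<le> zs ! l" if "finite I" "l \<in> I" for zs :: "'a list" and I l
    by (rule Inf_fin.coboundedI) (use that in auto)
  show "median k xs \<le> median k ys"
  proof (rule median_leI[OF k])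
    fix I assume I: "I \<subseteq> {..<length xs}" "card I = length xs + 1 - k" "finite I" "I \<noteq> {}"
    show "Inf_fin ((!) xs ` I) \<le> median k ys"
    \<comment> \<open>Only here can passing to \<open>ys\<close> lower the meet over
      \<open>I\<close>: the entry at \<open>i\<close> shrinks and nothing in \<open>I\<close>
      compensates. Trading \<open>i\<close> for \<open>j\<close> repairs this, as
      \<open>ys ! j\<close> lies above \<open>xs ! i\<close>.\<close>
    proof (cases "i \<in> I \<and> j \<notin> I")
      case True
      have "Inf_fin ((!) xs ` I) \<le> Inf_fin ((!) ys ` swp i j I)"
      proof (rule Inf_fin.boundedI)
        fix a assume "a \<in> (!) ys ` swp i j I"
        then consider "a = ys ! j" | l where "l \<in> I" "l \<noteq> i" "l \<noteq> j" "a = ys ! l"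
          unfolding swp_def by blast
        then show "Inf_fin ((!) xs ` I) \<le> a"
          using True I lower[of I _ xs] by cases (auto simp: yj eq intro: le_supI1)
      qed (use I in \<open>auto simp: swp_def\<close>)
      also have "\<dots> \<le> median k ys"
        using swp[of I i j] I True ij len by (intro Inf_fin_le_median) auto
      finally show ?thesis .
    next
      case False
      have "Inf_fin ((!) xs ` I) \<le> Inf_fin ((!) ys ` I)"
      proof (rule Inf_fin.boundedI)
        fix a assume "a \<in> (!) ys ` I"
        then obtain l where l: "l \<in> I" "a = ys ! l" by blast
        then show "Inf_fin ((!) xs ` I) \<le> a"
          using False I lower[of I _ xs]
          by (cases "l = i"; cases "l = j") (auto simp: yi yj eq intro: le_supI2)
      qed (use I in auto)
      also have "\<dots> \<le> median k ys"
        using I len by (intro Inf_fin_le_median) auto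
      finally show ?thesis .
    qed
  qed
  show "median k ys \<le> median k xs"
  proof (rule median_leI)
    fix I assume I: "I \<subseteq> {..<length ys}" "card I = length ys + 1 - k" "finite I" "I \<noteq> {}"
    show "Inf_fin ((!) ys ` I) \<le> median k xs"
    \<comment> \<open>If \<open>i \<in> I\<close>, the entry \<open>ys ! i\<close> bounds the meet
      by both old entries, and without \<open>i\<close> and \<open>j\<close> nothing changes. In the
      remaining case the meet lies below the join of the old entries but perhaps below neither, so
      two index sets for \<open>xs\<close> are used: \<open>I\<close> and its trade of
      \<open>j\<close> for \<open>i\<close>.\<close>
    proof (cases "j \<in> I \<and> i \<notin> I")
      case True
      let ?y = "Inf_fin ((!) ys ` I)"
      have "inf ?y (xs ! j) \<le> Inf_fin ((!) xs ` I)"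
      proof (rule Inf_fin.boundedI)
        fix a assume "a \<in> (!) xs ` I"
        then obtain l where l: "l \<in> I" "a = xs ! l" by blast
        then show "inf ?y (xs ! j) \<le> a"
          using True I lower[of I l ys] eq[of l]
          by (cases "l = j"; cases "l = i") (auto intro: le_infI1)
      qed (use I in auto)
      also have "\<dots> \<le> median k xs"
        using I len by (intro Inf_fin_le_median) auto
      finally have 1: "inf ?y (xs ! j) \<le> median k xs" .
      have "inf ?y (xs ! i) \<le> Inf_fin ((!) xs ` swp j i I)"
      proof (rule Inf_fin.boundedI)
        fix a assume "a \<in> (!) xs ` swp j i I"
        then consider "a = xs ! i" | l where "l \<in> I" "l \<noteq> i" "l \<noteq> j" "a = xs ! l"
          unfolding swp_def using True by blast
        then show "inf ?y (xs ! i) \<le> a"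
          using I lower[of I _ ys] by cases (auto simp: eq[symmetric] intro: le_infI1)
      qed (use I in \<open>auto simp: swp_def\<close>)
      also have "\<dots> \<le> median k xs"
        using swp[of I j i] I True ij len by (intro Inf_fin_le_median) auto
      finally have 2: "inf ?y (xs ! i) \<le> median k xs" .
      \<comment> \<open>Distributivity splits the meet into the two pieces bounded in
        \<open>1\<close> and \<open>2\<close>.\<close>
      have "?y = inf ?y (sup (xs ! i) (xs ! j))"
        using lower[of I j ys] True I by (simp add: yj inf_absorb1)
      also have "\<dots> \<le> median k xs" using 1 2 by (simp add: inf_sup_distrib1)
      finally show ?thesis .
    next
      case False
      have "Inf_fin ((!) ys ` I) \<le> Inf_fin ((!) xs ` I)"
      proof (rule Inf_fin.boundedI)
        fix a assume "a \<in> (!) xs ` I"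
        then obtain l where l: "l \<in> I" "a = xs ! l" by blast
        then show "Inf_fin ((!) ys ` I) \<le> a"
          using False I lower[of I l ys] lower[of I i ys]
          by (cases "l = i"; cases "l = j") (auto simp: yi eq)
      qed (use I in auto)
      also have "\<dots> \<le> median k xs"
        using I len by (intro Inf_fin_le_median) auto
      finally show ?thesis .
    qed
  qed (use k len in auto)
qed

lemma medians_lattice_sort:
  fixes xs :: "'a::distrib_lattice list"
  shows "map (\<lambda>k. median k xs) [1..<length xs + 1] = lattice_sort xs"
proof -
  have "median k xs = median k (lattice_sort xs)" if k: "1 \<le> k" "k \<le> length xs" for k
  proof -
    have "median k ([] @ xs) = median k ([] @ lattice_sort xs)"
    proof (rule exchange_invariant_lattice_sort[where n = "length xs"])
      fix us vs :: "'a list" and a b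
      assume "length us + length vs + 2 = length xs"
      then show "median k (us @ a # b # vs) = median k (us @ inf a b # sup a b # vs)"
        by (intro median_exchange[where i = "length us" and j = "Suc (length us)"])
           (use k in \<open>auto simp: nth_append nth_Cons split: nat.split\<close>)
    qed simp
    then show ?thesis by simp
  qed
  then have "map (\<lambda>k. median k xs) [1..<length xs + 1]
      = map (\<lambda>k. median k (lattice_sort xs)) [1..<length (lattice_sort xs) + 1]"
    by auto
  also have "\<dots> = lattice_sort xs" by (rule medians_sorted[OF sorted_wrt_lattice_sort])
  finally show ?thesis .
qed

section \<open>Exchanges under symmetric lattice n-homomorphisms\<close>

lemma symmetric_map_mset_cong:
  assumes "symmetric_map n T" "length xs = n" "mset xs = mset ys"
  shows "T xs = T ys"
proof -
  obtain p where "p permutes {..<length ys}" "permute_list p ys = xs"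
    using mset_eq_permutation[OF assms(3)] by blast
  moreover have "length ys = n" using assms(2,3) mset_eq_length by metis
  ultimately show ?thesis using assms(1) unfolding symmetric_map_def by metis
qed

lemma lattice_n_hom_append:
  assumes "lattice_n_hom n T" "length us + length vs + 1 = n"
  shows "T (us @ sup a b # vs) = sup (T (us @ a # vs)) (T (us @ b # vs))"
    and "T (us @ inf a b # vs) = inf (T (us @ a # vs)) (T (us @ b # vs))"
  using assms(1)[unfolded lattice_n_hom_def, rule_format, of "us @ a # vs" "length us" b] assms(2)
  by auto

text \<open>Freezing all arguments but two adjacent ones leaves a symmetric map \<open>S\<close>
  that is a lattice homomorphism in each variable; the claim concerns \<open>S\<close>
  alone.\<close>

lemma symmetric_lattice_n_hom_exchange:
  fixes T :: "'a::lattice list \<Rightarrow> 'b::lattice"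
  assumes hom: "lattice_n_hom n T" and sym: "symmetric_map n T"
    and n: "length us + length vs + 2 = n"
  shows "T (us @ a # b # vs) = T (us @ inf a b # sup a b # vs)"
proof -
  define S where "S x y = T (us @ x # y # vs)" for x y
  have comm: "S x y = S y x" for x y
    unfolding S_def by (rule symmetric_map_mset_cong[OF sym]) (use n in auto)
  have S1: "S (sup x y) z = sup (S x z) (S y z)" "S (inf x y) z = inf (S x z) (S y z)" for x y z
    unfolding S_def using lattice_n_hom_append[OF hom, of us "z # vs"] n by auto
  have S2: "S z (sup x y) = sup (S z x) (S z y)" "S z (inf x y) = inf (S z x) (S z y)" for x y z
    by (simp_all only: comm[of z] S1)
  \<comment> \<open>\<open>S (inf a b) (sup a b)\<close> is a join of elements below \<open>S a b\<close>, while \<open>S (sup a b) (inf a b)\<close>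
    is a meet of elements above it.\<close>
  have "S (inf a b) (sup a b) = sup (inf (S a a) (S a b)) (inf (S a b) (S b b))"
    by (simp only: S1 S2 comm[of b a])
  then have "S (inf a b) (sup a b) \<le> S a b" by simp
  moreover have "S (sup a b) (inf a b) = inf (sup (S a a) (S a b)) (sup (S a b) (S b b))"
    by (simp only: S1(1) S2(2) comm[of b a])
  then have "S a b \<le> S (sup a b) (inf a b)" by simp
  \<comment> \<open>By symmetry the lower and the upper bound are the same value, which squeezes
    \<open>S a b\<close>.\<close>
  ultimately show ?thesis using comm[of "sup a b"] unfolding S_def by auto
qed

theorem theorem4p1:
  fixes T :: "'a::distrib_lattice list \<Rightarrow> 'b::distrib_lattice" and n :: nat
  assumes "n \<ge> 2"
    and "lattice_n_hom n T"
  shows "total_orderization_invariant n T \<longleftrightarrow> symmetric_map n T"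
proof
  assume toi: "total_orderization_invariant n T"
  show "symmetric_map n T"
    unfolding symmetric_map_def
  proof (intro allI impI)
    fix xs :: "'a list" and p
    assume n: "length xs = n" and p: "p permutes {..<n}"
    \<comment> \<open>Both lists have the same medians, and invariance gives each the value of
      \<open>T\<close> there.\<close>
    have "T (permute_list p xs) = T (map (\<lambda>k. median k (permute_list p xs)) [1..<n + 1])"
      by (rule toi[unfolded total_orderization_invariant_def, rule_format]) (simp add: n)
    also have "\<dots> = T (map (\<lambda>k. median k xs) [1..<n + 1])"
      using median_permute_list[of p xs] n p by simp
    also have "\<dots> = T xs"
      by (rule toi[unfolded total_orderization_invariant_def, rule_format, symmetric]) (rule n)
    finally show "T (permute_list p xs) = T xs" .
  qed
next
  assume sym: "symmetric_map n T"
  show "total_orderization_invariant n T"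
    unfolding total_orderization_invariant_def
  proof (intro allI impI)
    fix xs :: "'a list"
    assume n: "length xs = n"
    \<comment> \<open>Exchanges carry \<open>xs\<close> to \<open>lattice_sort xs\<close> without
      changing \<open>T\<close>, and that list consists of the medians of \<open>xs\<close>.\<close>
    have "T ([] @ xs) = T ([] @ lattice_sort xs)"
      by (rule exchange_invariant_lattice_sort[where n = n,
            OF symmetric_lattice_n_hom_exchange[OF assms(2) sym]])
         (use n in simp_all)
    then show "T xs = T (map (\<lambda>k. median k xs) [1..<n + 1])"
      using medians_lattice_sort[of xs] n by simp
  qed
qed

end
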